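(* If the boundary condition is periodic or the solution has compact support, then the three-dimensional CT scheme together with the mechanical energy update given in the context conserves the total energy: $$\sum_{i,j,k}\left(E^n_{ijk}+\frac12|\bm B^n_{ijk}|^2\right)=\sum_{i,j,k}\left(E^{n+1}_{ijk}+\frac12|\bm B^{n+1}_{ijk}|^2\right).$$
   Context: Uniform 3D grid with spacings $\Delta x,\Delta y,\Delta z>0$, time step $\Delta t>0$. Either indices $(i,j,k)$ are taken periodically and sums run over one period, or (compact support) the grid is $\mathbb Z^3$, $\bm B,\bm v$ at both time levels vanish outside a finite set of cells, and sums run over a finite block of cells containing that set. $\bm B_{ijk}=(B^x,B^y,B^z)^\top_{ijk}$, $\bm v_{ijk}=(v^x,v^y,v^z)^\top_{ijk}\in\mathbb R^3$, $\rho^{n+1}_{ijk}=\rho^n_{ijk}>0$ (density is unchanged in this step), $E_{ijk}\in\mathbb R$ is the mechanical energy (internal plus kinetic). Set $\bm B^{n+\frac12}_{ijk}=\frac12(\bm B^n_{ijk}+\bm B^{n+1}_{ijk})$, $\bm v^{n+\frac12}_{ijk}=\frac12(\bm v^n_{ijk}+\bm v^{n+1}_{ijk})$, $\mathbf\Omega^{n+\frac12}_{ijk}=\bm B^{n+\frac12}_{ijk}\times\bm v^{n+\frac12}_{ijk}=(\Omega^x,\Omega^y,\Omega^z)^{n+\frac12}_{ijk}$. For a grid function $f$: $D_xf_{ijk}=\frac{f_{i+1,j,k}-f_{i-1,j,k}}{2\Delta x}$, $D_yf_{ijk}=\frac{f_{i,j+1,k}-f_{i,j-1,k}}{2\Delta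 y}$, $D_zf_{ijk}=\frac{f_{i,j,k+1}-f_{i,j,k-1}}{2\Delta z}$. The (implicit) CT scheme is, at every $(i,j,k)$, $$B^{x,n+1}=B^{x,n}-\Delta t\,D_y\Omega^{z,n+\frac12}+\Delta t\,D_z\Omega^{y,n+\frac12},\quad B^{y,n+1}=B^{y,n}+\Delta t\,D_x\Omega^{z,n+\frac12}-\Delta t\,D_z\Omega^{x,n+\frac12},$$ $$B^{z,n+1}=B^{z,n}-\Delta t\,D_x\Omega^{y,n+\frac12}+\Delta t\,D_y\Omega^{x,n+\frac12},\quad \rho^n\bm v^{n+1}=\rho^n\bm v^n-\Delta t\,\bm B^{n+\frac12}\times\operatorname{curl}\bm B^{n+\frac12},$$ with $\operatorname{curl}\bm B=(D_yB^z-D_zB^y,\ D_zB^x-D_xB^z,\ D_xB^y-D_yB^x)^\top$. Mechanical energy update: $E^{n+1}_{ijk}=E^n_{ijk}-\frac12\rho^n_{ijk}|\bm v^n_{ijk}|^2+\frac12\rho^{n+1}_{ijk}|\bm v^{n+1}_{ijk}|^2$. *)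

theory Defs
  imports "HOL-Analysis.Analysis"
begin

unbundle cross3_syntax

text \<open>
  Grid functions live on all of \<open>int \<times> int \<times> int\<close>; on a periodic grid they are the periodic
  extensions of the values on one period.
\<close>

type_synonym 'a grid = "int \<Rightarrow> int \<Rightarrow> int \<Rightarrow> 'a"

definition Dx :: "real \<Rightarrow> real grid \<Rightarrow> real grid" where
  "Dx \<Delta>x f i j k = (f (i + 1) j k - f (i - 1) j k) / (2 * \<Delta>x)"

definition Dy :: "real \<Rightarrow> real grid \<Rightarrow> real grid" where
  "Dy \<Delta>y f i j k = (f i (j + 1) k - f i (j - 1) k) / (2 * \<Delta>y)"

definition Dz :: "real \<Rightarrow> real grid \<Rightarrow> real grid" where
  "Dz \<Delta>z f i j k = (f i j (k + 1) - f i j (k - 1)) / (2 * \<Delta>z)"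

definition component :: "(real^3) grid \<Rightarrow> 3 \<Rightarrow> real grid" where
  "component F m i j k = F i j k $ m"

definition curl :: "real \<Rightarrow> real \<Rightarrow> real \<Rightarrow> (real^3) grid \<Rightarrow> (real^3) grid" where
  "curl \<Delta>x \<Delta>y \<Delta>z F i j k = vector
     [Dy \<Delta>y (component F 3) i j k - Dz \<Delta>z (component F 2) i j k,
      Dz \<Delta>z (component F 1) i j k - Dx \<Delta>x (component F 3) i j k,
      Dx \<Delta>x (component F 2) i j k - Dy \<Delta>y (component F 1) i j k]"

definition half_level :: "(real^3) grid \<Rightarrow> (real^3) grid \<Rightarrow> (real^3) grid" where
  "half_level F F' i j k = (1 / 2) *\<^sub>R (F i j k + F' i j k)"

definition Omega_half ::
  "(real^3) grid \<Rightarrow> (real^3) grid \<Rightarrow> (real^3) grid \<Rightarrow> (real^3) grid \<Rightarrow> (real^3) grid" where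
  "Omega_half B B' v v' i j k = half_level B B' i j k \<times> half_level v v' i j k"

text \<open>
  Throughout, unprimed fields are at time level \<open>n\<close> and primed fields at level \<open>n + 1\<close>. The
  scheme is implicit, hence a relation between the two levels.
\<close>

definition ct_scheme ::
  "real \<Rightarrow> real \<Rightarrow> real \<Rightarrow> real \<Rightarrow> real grid \<Rightarrow>
   (real^3) grid \<Rightarrow> (real^3) grid \<Rightarrow> (real^3) grid \<Rightarrow> (real^3) grid \<Rightarrow> bool" where
  "ct_scheme \<Delta>t \<Delta>x \<Delta>y \<Delta>z \<rho> B B' v v' \<longleftrightarrow>
     (let \<Omega> = Omega_half B B' v v'; Bh = half_level B B' in
      \<forall>i j k.
        B' i j k $ 1 = B i j k $ 1 - \<Delta>t * Dy \<Delta>y (component \<Omega> 3) i j k + \<Delta>t * Dz \<Delta>z (component \<Omega> 2) i j k \<and>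
        B' i j k $ 2 = B i j k $ 2 + \<Delta>t * Dx \<Delta>x (component \<Omega> 3) i j k - \<Delta>t * Dz \<Delta>z (component \<Omega> 1) i j k \<and>
        B' i j k $ 3 = B i j k $ 3 - \<Delta>t * Dx \<Delta>x (component \<Omega> 2) i j k + \<Delta>t * Dy \<Delta>y (component \<Omega> 1) i j k \<and>
        \<rho> i j k *\<^sub>R v' i j k =
          \<rho> i j k *\<^sub>R v i j k - \<Delta>t *\<^sub>R (Bh i j k \<times> curl \<Delta>x \<Delta>y \<Delta>z Bh i j k))"

definition mech_energy_update ::
  "real grid \<Rightarrow> real grid \<Rightarrow> (real^3) grid \<Rightarrow> (real^3) grid \<Rightarrow> real grid \<Rightarrow> real grid \<Rightarrow> bool" where
  "mech_energy_update \<rho> \<rho>' v v' E E' \<longleftrightarrow>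
     (\<forall>i j k. E' i j k =
        E i j k - 1 / 2 * \<rho> i j k * (norm (v i j k))\<^sup>2 + 1 / 2 * \<rho>' i j k * (norm (v' i j k))\<^sup>2)"

unbundle no cross3_syntax

definition block :: "int \<Rightarrow> int \<Rightarrow> int \<Rightarrow> nat \<Rightarrow> nat \<Rightarrow> nat \<Rightarrow> (int \<times> int \<times> int) set" where
  "block i0 j0 k0 Nx Ny Nz =
     {i0..<i0 + int Nx} \<times> {j0..<j0 + int Ny} \<times> {k0..<k0 + int Nz}"

definition periodic :: "nat \<Rightarrow> nat \<Rightarrow> nat \<Rightarrow> 'a grid \<Rightarrow> bool" where
  "periodic Nx Ny Nz f \<longleftrightarrow>
     (\<forall>i j k. f (i + int Nx) j k = f i j k \<and> f i (j + int Ny) k = f i j k \<and>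
              f i j (k + int Nz) = f i j k)"

definition vanishes_outside :: "(int \<times> int \<times> int) set \<Rightarrow> (real^3) grid \<Rightarrow> bool" where
  "vanishes_outside S F \<longleftrightarrow> (\<forall>i j k. (i, j, k) \<notin> S \<longrightarrow> F i j k = 0)"

end

theory Submission
  imports Defs
begin

text \<open>
  The scheme reads \<open>B' - B = - \<Delta>t curl \<Omega>\<close> and \<open>\<rho> (v' - v) = - \<Delta>t B\<^sub>h \<times> curl B\<^sub>h\<close>. Since
  \<open>B\<^sub>h\<close> and \<open>v\<^sub>h\<close> are midpoints, pairing with them gives exactly the changes of the magnetic and
  kinetic energies, and by the cyclic symmetry of the triple product the change of the total
  energy in a cell is \<open>\<Delta>t (curl B\<^sub>h \<bullet> \<Omega> - B\<^sub>h \<bullet> curl \<Omega>)\<close>. The discrete curl is symmetric under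
  either boundary condition, because central differences are antisymmetric, so the sum over all
  cells vanishes.
\<close>

text \<open>The summand telescopes: it equals \<open>h i - h (i - 1)\<close> with \<open>h i = f (i + 1) g i + f i g (i + 1)\<close>.\<close>

lemma sum_central_difference_by_parts:
  fixes f g :: "int \<Rightarrow> real" and a :: int and N :: nat
  shows "(\<Sum>i\<in>{a..<a + int N}. (f (i + 1) - f (i - 1)) * g i + f i * (g (i + 1) - g (i - 1))) =
         (f (a + int N) * g (a + int N - 1) + f (a + int N - 1) * g (a + int N)) -
         (f a * g (a - 1) + f (a - 1) * g a)"
proof (induction N)
  case 0
  then show ?case by simp
next
  case (Suc N)
  \<comment> \<open>Naming the upper end keeps \<open>int (Suc N)\<close> out of the arithmetic: the
    added summand sits at \<open>b\<close>, and the boundary terms move from \<open>b - 1\<close>,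
    \<open>b\<close> to \<open>b\<close>, \<open>b + 1\<close>.\<close>
  define b where "b = a + int N"
  have "a + int (Suc N) = b + 1" and "{a..<b + 1} = insert b {a..<b}"
    by (auto simp: b_def)
  with Suc show ?case
    unfolding b_def[symmetric] by (simp add: algebra_simps)
qed

lemma sum_block:
  "(\<Sum>(i, j, k)\<in>block i0 j0 k0 Nx Ny Nz. f i j k) =
   (\<Sum>i\<in>{i0..<i0 + int Nx}. \<Sum>j\<in>{j0..<j0 + int Ny}. \<Sum>k\<in>{k0..<k0 + int Nz}. f i j k)"
  unfolding block_def by (simp add: sum.cartesian_product)

text \<open>Both boundary conditions in one predicate on a pair of fields, so that summation by
  parts is carried out only once.\<close>

definition closed_boundary ::
  "int \<Rightarrow> int \<Rightarrow> int \<Rightarrow> nat \<Rightarrow> nat \<Rightarrow> nat \<Rightarrow> (real^3) grid \<Rightarrow> (real^3) grid \<Rightarrow> bool" where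
  "closed_boundary i0 j0 k0 Nx Ny Nz F G \<longleftrightarrow>
     periodic Nx Ny Nz F \<and> periodic Nx Ny Nz G \<or>
     vanishes_outside (block i0 j0 k0 Nx Ny Nz) F \<and> vanishes_outside (block i0 j0 k0 Nx Ny Nz) G"

lemma periodic_prev:
  assumes "periodic Nx Ny Nz f"
  shows "f (i + int Nx - 1) j k = f (i - 1) j k"
    and "f i (j + int Ny - 1) k = f i (j - 1) k"
    and "f i j (k + int Nz - 1) = f i j (k - 1)"
  using assms[unfolded periodic_def, rule_format, of "i - 1" j k]
    assms[unfolded periodic_def, rule_format, of i "j - 1" k]
    assms[unfolded periodic_def, rule_format, of i j "k - 1"]
  by (simp_all add: algebra_simps)

text \<open>These are the boundary terms left over after telescoping in each direction. For periodic
  fields the upper and lower ones agree by a shift through one period; for vanishing fields each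
  product has a factor one cell outside the block, so all of them are zero.\<close>

lemma closed_boundary_flux:
  assumes "closed_boundary i0 j0 k0 Nx Ny Nz F G"
  shows "F (i0 + int Nx) j k $ m * G (i0 + int Nx - 1) j k $ n +
         F (i0 + int Nx - 1) j k $ m * G (i0 + int Nx) j k $ n =
         F i0 j k $ m * G (i0 - 1) j k $ n + F (i0 - 1) j k $ m * G i0 j k $ n"
    and "F i (j0 + int Ny) k $ m * G i (j0 + int Ny - 1) k $ n +
         F i (j0 + int Ny - 1) k $ m * G i (j0 + int Ny) k $ n =
         F i j0 k $ m * G i (j0 - 1) k $ n + F i (j0 - 1) k $ m * G i j0 k $ n"
    and "F i j (k0 + int Nz) $ m * G i j (k0 + int Nz - 1) $ n +
         F i j (k0 + int Nz - 1) $ m * G i j (k0 + int Nz) $ n =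
         F i j k0 $ m * G i j (k0 - 1) $ n + F i j (k0 - 1) $ m * G i j k0 $ n"
proof -
  have per: "f (i0 + int Nx) j k = f i0 j k" "f (i0 + int Nx - 1) j k = f (i0 - 1) j k"
    "f i (j0 + int Ny) k = f i j0 k" "f i (j0 + int Ny - 1) k = f i (j0 - 1) k"
    "f i j (k0 + int Nz) = f i j k0" "f i j (k0 + int Nz - 1) = f i j (k0 - 1)"
    if "periodic Nx Ny Nz f" for f :: "(real^3) grid"
    using periodic_prev[OF that] that by (simp_all add: periodic_def)
  have van: "f (i0 + int Nx) j k = 0" "f (i0 - 1) j k = 0"
    "f i (j0 + int Ny) k = 0" "f i (j0 - 1) k = 0"
    "f i j (k0 + int Nz) = 0" "f i j (k0 - 1) = 0"
    if "vanishes_outside (block i0 j0 k0 Nx Ny Nz) f" for f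
    using that by (simp_all add: vanishes_outside_def block_def)
  show
    "F (i0 + int Nx) j k $ m * G (i0 + int Nx - 1) j k $ n +
     F (i0 + int Nx - 1) j k $ m * G (i0 + int Nx) j k $ n =
     F i0 j k $ m * G (i0 - 1) j k $ n + F (i0 - 1) j k $ m * G i0 j k $ n"
    "F i (j0 + int Ny) k $ m * G i (j0 + int Ny - 1) k $ n +
     F i (j0 + int Ny - 1) k $ m * G i (j0 + int Ny) k $ n =
     F i j0 k $ m * G i (j0 - 1) k $ n + F i (j0 - 1) k $ m * G i j0 k $ n"
    "F i j (k0 + int Nz) $ m * G i j (k0 + int Nz - 1) $ n +
     F i j (k0 + int Nz - 1) $ m * G i j (k0 + int Nz) $ n =
     F i j k0 $ m * G i j (k0 - 1) $ n + F i j (k0 - 1) $ m * G i j k0 $ n"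
    using assms unfolding closed_boundary_def by (elim disjE conjE; simp add: per van)+
qed

text \<open>Discrete integration by parts without boundary terms. The components \<open>m\<close>
  and \<open>n\<close> are independent because the curl couples different components.\<close>

lemma
  assumes "closed_boundary i0 j0 k0 Nx Ny Nz F G"
  shows sum_Dx_by_parts:
      "(\<Sum>(i, j, k)\<in>block i0 j0 k0 Nx Ny Nz.
          Dx d (component F m) i j k * G i j k $ n + F i j k $ m * Dx d (component G n) i j k) = 0"
      (is "?X = 0")
    and sum_Dy_by_parts:
      "(\<Sum>(i, j, k)\<in>block i0 j0 k0 Nx Ny Nz.
          Dy d (component F m) i j k * G i j k $ n + F i j k $ m * Dy d (component G n) i j k) = 0"
      (is "?Y = 0")
    and sum_Dz_by_parts:
      "(\<Sum>(i, j, k)\<in>block i0 j0 k0 Nx Ny Nz.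
          Dz d (component F m) i j k * G i j k $ n + F i j k $ m * Dz d (component G n) i j k) = 0"
      (is "?Z = 0")
proof -
  let ?I = "{i0..<i0 + int Nx}" and ?J = "{j0..<j0 + int Ny}" and ?K = "{k0..<k0 + int Nz}"
  note flux = closed_boundary_flux[OF assms]
  have "?X = (\<Sum>i\<in>?I. \<Sum>j\<in>?J. \<Sum>k\<in>?K.
      ((F (i + 1) j k $ m - F (i - 1) j k $ m) * G i j k $ n +
       F i j k $ m * (G (i + 1) j k $ n - G (i - 1) j k $ n)) / (2 * d))"
    unfolding sum_block Dx_def component_def by (simp add: add_divide_distrib)
  \<comment> \<open>The sum along the direction of differencing has to be innermost in order to
    telescope.\<close>
  also have "\<dots> = (\<Sum>j\<in>?J. \<Sum>k\<in>?K. (\<Sum>i\<in>?I.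
      (F (i + 1) j k $ m - F (i - 1) j k $ m) * G i j k $ n +
       F i j k $ m * (G (i + 1) j k $ n - G (i - 1) j k $ n)) / (2 * d))"
    unfolding sum_divide_distrib by (subst sum.swap) (intro sum.cong refl sum.swap)
  also have "\<dots> = 0"
    \<comment> \<open>The instantiation fixes which index is differenced; the dummies match the two
      transverse ones.\<close>
    unfolding sum_central_difference_by_parts[where f = "\<lambda>i. F i _ _ $ m" and g = "\<lambda>i. G i _ _ $ n"]
    by (simp add: flux)
  finally show "?X = 0" .
  have "?Y = (\<Sum>i\<in>?I. \<Sum>j\<in>?J. \<Sum>k\<in>?K.
      ((F i (j + 1) k $ m - F i (j - 1) k $ m) * G i j k $ n +
       F i j k $ m * (G i (j + 1) k $ n - G i (j - 1) k $ n)) / (2 * d))"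
    unfolding sum_block Dy_def component_def by (simp add: add_divide_distrib)
  also have "\<dots> = (\<Sum>i\<in>?I. \<Sum>k\<in>?K. (\<Sum>j\<in>?J.
      (F i (j + 1) k $ m - F i (j - 1) k $ m) * G i j k $ n +
       F i j k $ m * (G i (j + 1) k $ n - G i (j - 1) k $ n)) / (2 * d))"
    unfolding sum_divide_distrib by (intro sum.cong refl sum.swap)
  also have "\<dots> = 0"
    unfolding sum_central_difference_by_parts[where f = "\<lambda>j. F _ j _ $ m" and g = "\<lambda>j. G _ j _ $ n"]
    by (simp add: flux)
  finally show "?Y = 0" .
  have "?Z = (\<Sum>i\<in>?I. \<Sum>j\<in>?J. (\<Sum>k\<in>?K.
      (F i j (k + 1) $ m - F i j (k - 1) $ m) * G i j k $ n +
       F i j k $ m * (G i j (k + 1) $ n - G i j (k - 1) $ n)) / (2 * d))"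
    unfolding sum_block Dz_def component_def
    by (simp add: add_divide_distrib sum_divide_distrib)
  also have "\<dots> = 0"
    unfolding sum_central_difference_by_parts[where f = "\<lambda>k. F _ _ k $ m" and g = "\<lambda>k. G _ _ k $ n"]
    by (simp add: flux)
  finally show "?Z = 0" .
qed

text \<open>Two signs cancel: one from moving a central difference to the other factor, one from
  exchanging the two components in the antisymmetric pattern of the curl.\<close>

lemma sum_curl_symmetric:
  assumes "closed_boundary i0 j0 k0 Nx Ny Nz F G"
  shows "(\<Sum>(i, j, k)\<in>block i0 j0 k0 Nx Ny Nz.
            curl dx dy dz F i j k \<bullet> G i j k - F i j k \<bullet> curl dx dy dz G i j k) = 0"
proof -
  define X Y Z where
    "X m n i j k =
      Dx dx (component F m) i j k * G i j k $ n + F i j k $ m * Dx dx (component G n) i j k" and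
    "Y m n i j k =
      Dy dy (component F m) i j k * G i j k $ n + F i j k $ m * Dy dy (component G n) i j k" and
    "Z m n i j k =
      Dz dz (component F m) i j k * G i j k $ n + F i j k $ m * Dz dz (component G n) i j k"
    for m n i j k
  \<comment> \<open>Sorted by direction of differencing, the twelve products pair up into six
    complete product-rule expressions, each of which sums to zero by itself.\<close>
  have "curl dx dy dz F i j k \<bullet> G i j k - F i j k \<bullet> curl dx dy dz G i j k =
      X 2 3 i j k - X 3 2 i j k + (Y 3 1 i j k - Y 1 3 i j k) + (Z 1 2 i j k - Z 2 1 i j k)"
    for i j k
    by (simp add: X_def Y_def Z_def curl_def inner_vec_def sum_3 algebra_simps)
  moreover have "(\<Sum>(i, j, k)\<in>block i0 j0 k0 Nx Ny Nz. X m n i j k) = 0"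
    "(\<Sum>(i, j, k)\<in>block i0 j0 k0 Nx Ny Nz. Y m n i j k) = 0"
    "(\<Sum>(i, j, k)\<in>block i0 j0 k0 Nx Ny Nz. Z m n i j k) = 0" for m n
    unfolding X_def Y_def Z_def
    using assms by (rule sum_Dx_by_parts sum_Dy_by_parts sum_Dz_by_parts)+
  ultimately show ?thesis
    by (simp add: split_def sum.distrib sum_subtractf)
qed

text \<open>The mixed terms of \<open>(x + y) \<bullet> (y - x)\<close> cancel. This makes the
  energy balance of the time-centred scheme exact, with no remainder in
  \<open>\<Delta>t\<close>.\<close>

lemma norm_square_diff_midpoint:
  fixes x y :: "'a::real_inner"
  shows "(norm y)\<^sup>2 - (norm x)\<^sup>2 = 2 * (((1 / 2) *\<^sub>R (x + y)) \<bullet> (y - x))"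
  by (simp add: power2_norm_eq_inner inner_simps inner_commute)

lemma cell_energy_change:
  assumes "ct_scheme \<Delta>t \<Delta>x \<Delta>y \<Delta>z \<rho> B B' v v'"
    and "mech_energy_update \<rho> \<rho>' v v' E E'"
    and "\<rho>' i j k = \<rho> i j k"
  shows "(E' i j k + 1 / 2 * (norm (B' i j k))\<^sup>2) - (E i j k + 1 / 2 * (norm (B i j k))\<^sup>2) =
    \<Delta>t * (curl \<Delta>x \<Delta>y \<Delta>z (half_level B B') i j k \<bullet> Omega_half B B' v v' i j k -
          half_level B B' i j k \<bullet> curl \<Delta>x \<Delta>y \<Delta>z (Omega_half B B' v v') i j k)"
proof -
  let ?Bh = "half_level B B'" and ?vh = "half_level v v'" and ?\<Omega> = "Omega_half B B' v v'"
  let ?c = "curl \<Delta>x \<Delta>y \<Delta>z ?Bh i j k"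
  have "B' i j k - B i j k = - \<Delta>t *\<^sub>R curl \<Delta>x \<Delta>y \<Delta>z ?\<Omega> i j k"
    using assms(1) unfolding ct_scheme_def Let_def
    by (simp add: vec_eq_iff forall_3 curl_def algebra_simps)
  then have magnetic: "1 / 2 * ((norm (B' i j k))\<^sup>2 - (norm (B i j k))\<^sup>2) =
      - \<Delta>t * (?Bh i j k \<bullet> curl \<Delta>x \<Delta>y \<Delta>z ?\<Omega> i j k)"
    unfolding norm_square_diff_midpoint half_level_def by simp
  have "\<rho> i j k *\<^sub>R (v' i j k - v i j k) = - \<Delta>t *\<^sub>R cross3 (?Bh i j k) ?c"
    using assms(1) unfolding ct_scheme_def Let_def by (simp add: scaleR_diff_right)
  then have "?vh i j k \<bullet> (\<rho> i j k *\<^sub>R (v' i j k - v i j k)) =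
      - \<Delta>t * (?vh i j k \<bullet> cross3 (?Bh i j k) ?c)"
    by simp
  \<comment> \<open>Cyclic symmetry gives
    \<open>?c \<bullet> cross3 (?vh i j k) (?Bh i j k)\<close>; swapping the two factors yields the
    minus sign, which cancels the one in the momentum equation.\<close>
  moreover have "?vh i j k \<bullet> cross3 (?Bh i j k) ?c = - (?c \<bullet> ?\<Omega> i j k)"
    unfolding Omega_half_def by (simp add: cross3_def inner_vec_def sum_3 algebra_simps)
  ultimately have "1 / 2 * \<rho> i j k * ((norm (v' i j k))\<^sup>2 - (norm (v i j k))\<^sup>2) =
      \<Delta>t * (?c \<bullet> ?\<Omega> i j k)"
    unfolding norm_square_diff_midpoint half_level_def by simp
  \<comment> \<open>Equal densities let the two kinetic terms share one factor
    \<open>\<rho> i j k\<close>.\<close>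
  moreover have "E' i j k - E i j k =
      1 / 2 * \<rho> i j k * ((norm (v' i j k))\<^sup>2 - (norm (v i j k))\<^sup>2)"
    using assms(2,3) unfolding mech_energy_update_def by (simp add: right_diff_distrib)
  ultimately have "E' i j k - E i j k = \<Delta>t * (?c \<bullet> ?\<Omega> i j k)"
    by simp
  with magnetic show ?thesis
    by (simp add: algebra_simps)
qed

theorem corollary4p4:
  fixes \<Delta>t \<Delta>x \<Delta>y \<Delta>z :: real
    and \<rho> \<rho>' E E' :: "real grid"
    and B B' v v' :: "(real^3) grid"
    and i0 j0 k0 :: int and Nx Ny Nz :: nat
  assumes "\<Delta>t > 0" and "\<Delta>x > 0" and "\<Delta>y > 0" and "\<Delta>z > 0"
    and "\<And>i j k. \<rho> i j k > 0"
    and "\<And>i j k. \<rho>' i j k = \<rho> i j k"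
    and "ct_scheme \<Delta>t \<Delta>x \<Delta>y \<Delta>z \<rho> B B' v v'"
    and "mech_energy_update \<rho> \<rho>' v v' E E'"
    and boundary:
      "(Nx \<ge> 1 \<and> Ny \<ge> 1 \<and> Nz \<ge> 1 \<and>
        periodic Nx Ny Nz B \<and> periodic Nx Ny Nz B' \<and>
        periodic Nx Ny Nz v \<and> periodic Nx Ny Nz v' \<and>
        periodic Nx Ny Nz \<rho> \<and> periodic Nx Ny Nz \<rho>' \<and>
        periodic Nx Ny Nz E \<and> periodic Nx Ny Nz E')
       \<or>
       (\<exists>S. finite S \<and> S \<subseteq> block i0 j0 k0 Nx Ny Nz \<and>
            vanishes_outside S B \<and> vanishes_outside S B' \<and>
            vanishes_outside S v \<and> vanishes_outside S v')"
  shows "(\<Sum>(i, j, k)\<in>block i0 j0 k0 Nx Ny Nz. E i j k + 1 / 2 * (norm (B i j k))\<^sup>2) =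
         (\<Sum>(i, j, k)\<in>block i0 j0 k0 Nx Ny Nz. E' i j k + 1 / 2 * (norm (B' i j k))\<^sup>2)"
proof -
  have "closed_boundary i0 j0 k0 Nx Ny Nz (half_level B B') (Omega_half B B' v v')"
    using boundary
  proof (elim disjE exE conjE)
    assume "periodic Nx Ny Nz B" "periodic Nx Ny Nz B'" "periodic Nx Ny Nz v" "periodic Nx Ny Nz v'"
    then show ?thesis
      by (simp add: closed_boundary_def periodic_def half_level_def Omega_half_def)
  next
    fix S
    assume "S \<subseteq> block i0 j0 k0 Nx Ny Nz" "vanishes_outside S B" "vanishes_outside S B'"
    then have "vanishes_outside (block i0 j0 k0 Nx Ny Nz) (half_level B B')"
      unfolding vanishes_outside_def half_level_def by (metis add_0 scaleR_zero_right subsetD)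
    \<comment> \<open>\<open>Omega_half\<close> inherits the vanishing from its factor
      \<open>half_level B B'\<close>.\<close>
    then show ?thesis
      by (simp add: closed_boundary_def vanishes_outside_def Omega_half_def)
  qed
  \<comment> \<open>Summing the cell balances gives \<open>\<Delta>t\<close> times this vanishing
    sum.\<close>
  from sum_curl_symmetric[OF this, of \<Delta>x \<Delta>y \<Delta>z]
  have "(\<Sum>(i, j, k)\<in>block i0 j0 k0 Nx Ny Nz.
      (E' i j k + 1 / 2 * (norm (B' i j k))\<^sup>2) - (E i j k + 1 / 2 * (norm (B i j k))\<^sup>2)) = 0"
    unfolding cell_energy_change[OF assms(7,8,6)] split_def sum_distrib_left[symmetric] by simp
  then show ?thesis
    by (simp add: split_def sum_subtractf)
qed

end
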